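(* Assume that $\mathcal{D}$ is deterministic and that the best-in-class error is achieved by some $h^*\in\mathcal{H}$, i.e. $\mathbb{E}[\ell(h^*(x),y)]=\inf_{h\in\mathcal{H}}\mathbb{E}[\ell(h(x),y)]$. Let $p_k=\mathbb{P}[y=k]$ for $k\in[n]$. Then the minimizability gap is null, $\mathcal{M}(\mathcal{H})=0$, if and only if $$\forall k\in[n],\quad \ell(h^*(x),k)=\ell_k\ \text{ a.s. over }\mathcal{X}_k.$$ If further $\alpha\mapsto\ell(\alpha,k)$ is injective and $\ell_k=\ell(\alpha_k,k)$ with $\alpha_k\in A$ for all $k\in[n]$, then the condition is equivalent to: $\forall k\in[n]$, $h^*(x)=\alpha_k$ a.s. for $x\in\mathcal{X}_k$. Furthermore, for $\epsilon\ge0$, the minimizability gap is bounded by $\epsilon$, $\mathcal{M}(\mathcal{H})\le\epsilon$, if and only if $$\sum_{k\in[n]}p_k\left(\mathbb{E}[\ell(h^*(x),k)\mid y=k]-\ell_k\right)\le\epsilon.$$ In particular, this condition implies $\mathbb{E}[\ell(h^*(x),k)\mid y=k]-\ell_k\le\frac{\epsilon}{p_k}$ for all $k\in[n]$ (with $p_k>0$).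
   Context: Multi-class classification: input space $\mathcal{X}$, label space $[n]=\{1,\ldots,n\}$, $\mathcal{D}$ a distribution over $\mathcal{X}\times[n]$; $\mathcal{H}$ is a family of measurable functions $h\colon\mathcal{X}\times[n]\to\mathbb{R}$, and $h(x)=[h(x,1),\ldots,h(x,n)]\in\mathbb{R}^n$ denotes the score vector. The surrogate loss of $h$ at $(x,y)$ is $\ell(h(x),y)$, with $\ell\colon\mathbb{R}^n\times[n]\to\mathbb{R}_+$ measurable. It is assumed that the set $A=\{h(x)\colon h\in\mathcal{H}\}\subseteq\mathbb{R}^n$ does not depend on $x\in\mathcal{X}$. $\mathcal{D}$ is deterministic if the conditional probabilities $\mathcal{D}(Y=y\mid X=x)$ are all $0$ or $1$; then $\mathcal{X}_k$ is the subset of $\mathcal{X}$ over which the label is $k$. $\ell_k=\inf_{\alpha\in A}\ell(\alpha,k)$. The minimizability gap is $\mathcal{M}(\mathcal{H})=\inf_{h\in\mathcal{H}}\mathbb{E}_{(x,y)\sim\mathcal{D}}[\ell(h(x),y)]-\mathbb{E}_x\left[\inf_{h\in\mathcal{H}}\mathbb{E}_y[\ell(h(x),y)\mid x]\right]$. Terms multiplied by a zero probability $p_k$ are read as $0$. "a.s. over $\mathcal{X}_k$" refers to the marginal distribution of $x$. *)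

theory Defs
  imports "HOL-Probability.Probability"
begin

text \<open>
  The label space is a finite type \<^typ>\<open>'n\<close>, so score vectors live in \<^typ>\<open>real ^ 'n\<close>.
  The measurable space \<open>X\<close> is the input space; only its \<open>space\<close> and \<open>sets\<close> are used.
  The distribution \<open>D\<close> is a probability measure on the product of \<open>X\<close> with the discrete label space.
\<close>

definition is_distribution_on :: "'a measure \<Rightarrow> ('a \<times> 'n::finite) measure \<Rightarrow> bool" where
  "is_distribution_on X D \<longleftrightarrow>
     prob_space D \<and> sets D = sets (X \<Otimes>\<^sub>M count_space (UNIV :: 'n set))"

definition marginal :: "'a measure \<Rightarrow> ('a \<times> 'n) measure \<Rightarrow> 'a measure" where
  "marginal X D = distr D X fst"

text \<open>
  The map \<open>K\<close> is a version of the conditional distribution of the label given the input: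
  \<open>pmf (K x) y\<close> is the probability of \<open>Y = y\<close> given \<open>X = x\<close>. Such a version always exists, the
  label space being finite, and is unique up to null sets of the marginal. A kernel, rather than
  a class of conditional expectations modulo null sets, is needed because the minimizability gap
  takes a pointwise infimum over a possibly uncountable family of hypotheses.
\<close>

definition is_cond_dist ::
  "'a measure \<Rightarrow> ('a \<times> 'n::finite) measure \<Rightarrow> ('a \<Rightarrow> 'n pmf) \<Rightarrow> bool" where
  "is_cond_dist X D K \<longleftrightarrow>
     (\<forall>y. (\<lambda>x. pmf (K x) y) \<in> borel_measurable X) \<and>
     (\<forall>B\<in>sets X. \<forall>y. emeasure D (B \<times> {y}) =
        (\<integral>\<^sup>+x\<in>B. ennreal (pmf (K x) y) \<partial>marginal X D))"

definition deterministic ::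
  "'a measure \<Rightarrow> ('a \<times> 'n::finite) measure \<Rightarrow> ('a \<Rightarrow> 'n pmf) \<Rightarrow> bool" where
  "deterministic X D K \<longleftrightarrow> (AE x in marginal X D. \<forall>y. pmf (K x) y \<in> {0, 1})"

definition label_region :: "'a measure \<Rightarrow> ('a \<Rightarrow> 'n pmf) \<Rightarrow> 'n \<Rightarrow> 'a set" where
  "label_region X K k = {x \<in> space X. pmf (K x) k = 1}"

definition label_prob :: "('a \<times> 'n) measure \<Rightarrow> 'n \<Rightarrow> real" where
  "label_prob D k = measure D {z \<in> space D. snd z = k}"

definition score :: "('a \<times> 'n::finite \<Rightarrow> real) \<Rightarrow> 'a \<Rightarrow> real ^ 'n" where
  "score h x = (\<chi> y. h (x, y))"

text \<open>
  Losses are nonnegative and not assumed integrable, so expectations are extended nonnegative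
  integrals; a Bochner integral would silently give \<open>0\<close> for a hypothesis of infinite error.
\<close>

definition error ::
  "('a \<times> 'n::finite) measure \<Rightarrow> (real ^ 'n \<Rightarrow> 'n \<Rightarrow> real) \<Rightarrow> ('a \<times> 'n \<Rightarrow> real) \<Rightarrow> ennreal" where
  "error D l h = (\<integral>\<^sup>+z. ennreal (l (score h (fst z)) (snd z)) \<partial>D)"

definition cond_error ::
  "('a \<Rightarrow> 'n::finite pmf) \<Rightarrow> (real ^ 'n \<Rightarrow> 'n \<Rightarrow> real) \<Rightarrow> ('a \<times> 'n \<Rightarrow> real) \<Rightarrow> 'a \<Rightarrow> ennreal" where
  "cond_error K l h x = (\<integral>\<^sup>+y. ennreal (l (score h x) y) \<partial>measure_pmf (K x))"

text \<open>
  The difference is taken in \<^typ>\<open>ereal\<close>, as subtraction on \<^typ>\<open>ennreal\<close> truncates at \<open>0\<close>.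
  For a deterministic distribution the subtrahend is finite, so \<open>\<infinity> - \<infinity>\<close> does not occur.
\<close>

definition minimizability_gap ::
  "'a measure \<Rightarrow> ('a \<times> 'n::finite) measure \<Rightarrow> ('a \<Rightarrow> 'n pmf) \<Rightarrow> (real ^ 'n \<Rightarrow> 'n \<Rightarrow> real)
     \<Rightarrow> ('a \<times> 'n \<Rightarrow> real) set \<Rightarrow> ereal" where
  "minimizability_gap X D K l H =
     enn2ereal (INF h\<in>H. error D l h)
       - enn2ereal (\<integral>\<^sup>+x. (INF h\<in>H. cond_error K l h x) \<partial>marginal X D)"

definition best_loss :: "(real ^ 'n::finite \<Rightarrow> 'n \<Rightarrow> real) \<Rightarrow> (real ^ 'n) set \<Rightarrow> 'n \<Rightarrow> real" where
  "best_loss l A k = (INF \<alpha>\<in>A. l \<alpha> k)"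

text \<open>
  The expectation of the loss given \<open>Y = k\<close>. It is meaningful for labels of positive probability;
  otherwise it only occurs multiplied by \<open>0\<close>, and \<open>0 * a = 0\<close> for every \<open>a\<close> in \<^typ>\<open>ereal\<close>.
\<close>

definition label_cond_error ::
  "('a \<times> 'n::finite) measure \<Rightarrow> (real ^ 'n \<Rightarrow> 'n \<Rightarrow> real) \<Rightarrow> ('a \<times> 'n \<Rightarrow> real) \<Rightarrow> 'n \<Rightarrow> ereal" where
  "label_cond_error D l h k =
     enn2ereal (\<integral>\<^sup>+z. ennreal (l (score h (fst z)) k)
       \<partial>uniform_measure D {z \<in> space D. snd z = k})"

end

theory Submission
  imports Defs
begin

text \<open>
  Slicing \<open>D\<close> along the labels gives
  \<open>error h = (\<Sum>k. \<integral> l (h x) k * K x k d\<mu>)\<close> with \<open>\<mu>\<close> the marginal. When the label is a function of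
  \<open>x\<close>, the pointwise infimum of the conditional error over \<open>X\<^sub>k\<close> is the constant \<open>best_loss k\<close>, so the
  subtrahend of the gap is the finite number \<open>\<Sum>k. p k * best_loss k\<close>. Hence the gap is the sum over
  \<open>k\<close> of the nonnegative excesses \<open>\<integral> (l (h* x) k - best_loss k) * K x k d\<mu>\<close>, and every claim is a
  claim on these excesses.
\<close>

section \<open>Infima in \<open>ennreal\<close>, point masses and measurability of score
  vectors\<close>

lemma ennreal_cINF:
  fixes f :: "'a \<Rightarrow> real"
  assumes "I \<noteq> {}" "\<And>i. i \<in> I \<Longrightarrow> 0 \<le> f i"
  shows "(INF i\<in>I. ennreal (f i)) = ennreal (INF i\<in>I. f i)"
proof (rule antisym)
  have bdd: "bdd_below (f ` I)"
    using assms(2) by (intro bdd_belowI[of _ 0]) auto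
  show "ennreal (INF i\<in>I. f i) \<le> (INF i\<in>I. ennreal (f i))"
    by (intro INF_greatest ennreal_leI cINF_lower bdd)
  \<comment> \<open>Over an empty \<open>I\<close> this infimum would be \<open>top\<close>;
    nonemptiness makes it finite, so it survives the passage through \<open>enn2real\<close> and
    back.\<close>
  have fin: "(INF i\<in>I. ennreal (f i)) \<noteq> top"
    using assms(1) by (metis INF_lower ennreal_less_top ex_in_conv leD)
  have "enn2real (INF i\<in>I. ennreal (f i)) \<le> (INF i\<in>I. f i)"
  proof (rule cINF_greatest[OF assms(1)])
    fix i assume "i \<in> I"
    then show "enn2real (INF i\<in>I. ennreal (f i)) \<le> f i"
      using assms(2) by (intro enn2real_leI INF_lower) auto
  qed
  then show "(INF i\<in>I. ennreal (f i)) \<le> ennreal (INF i\<in>I. f i)"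
    using fin by (metis ennreal_enn2real ennreal_leI top.not_eq_extremum)
qed

text \<open>A second atom \<open>j\<close> would give \<open>{j, k}\<close> a mass above
  \<open>1\<close>.\<close>

lemma pmf_eq_1_iff: "pmf p k = 1 \<longleftrightarrow> p = return_pmf k"
proof
  assume k: "pmf p k = 1"
  have "set_pmf p \<subseteq> {k}"
  proof
    fix j assume "j \<in> set_pmf p"
    then have "pmf p j > 0"
      by (simp add: pmf_positive_iff)
    moreover have "pmf p j + pmf p k \<le> 1" if "j \<noteq> k"
      using that measure_pmf.prob_le_1[of p "{j, k}"] by (simp add: measure_measure_pmf_finite)
    ultimately show "j \<in> {k}"
      using k by force
  qed
  then show "p = return_pmf k"
    by (simp add: set_pmf_subset_singleton)
qed simp

text \<open>The masses sum to \<open>1\<close> over the finite type, so one of them is nonzero. This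
  turns the 0-1 condition into a point mass, at which a conditional error is a single loss
  value.\<close>

lemma deterministic_pmf_eq_return:
  fixes p :: "'n::finite pmf"
  assumes "\<forall>y. pmf p y \<in> {0, 1}"
  obtains k where "p = return_pmf k"
proof -
  have "(\<Sum>y\<in>UNIV. pmf p y) = 1"
    by (rule sum_pmf_eq_1) auto
  then obtain k where "pmf p k \<noteq> 0"
    by (metis sum.neutral zero_neq_one)
  with assms have "pmf p k = 1"
    by auto
  with that show thesis
    by (simp add: pmf_eq_1_iff)
qed

lemma measurable_score:
  fixes h :: "'a \<times> 'n::finite \<Rightarrow> real"
  assumes "h \<in> borel_measurable (X \<Otimes>\<^sub>M count_space UNIV)"
  shows "score h \<in> borel_measurable X"
proof (subst borel_measurable_euclidean_space, rule ballI)
  fix i :: "real ^ 'n" assume "i \<in> Basis"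
  then obtain y where i: "i = axis y 1"
    by (auto simp: Basis_vec_def)
  have "(\<lambda>x. h (x, y)) \<in> borel_measurable X"
    by (rule measurable_compose[OF _ assms]) simp
  then show "(\<lambda>x. score h x \<bullet> i) \<in> borel_measurable X"
    by (simp add: i score_def inner_axis)
qed

section \<open>Slices of \<open>D\<close> along the labels as densities over the marginal\<close>

locale labelled_distribution =
  fixes X :: "'a measure" and D :: "('a \<times> 'n::finite) measure" and K :: "'a \<Rightarrow> 'n pmf"
  assumes dist: "is_distribution_on X D"
    and cond_dist: "is_cond_dist X D K"
begin

sublocale D: prob_space D
  using dist by (simp add: is_distribution_on_def)

lemma sets_D [measurable_cong]: "sets D = sets (X \<Otimes>\<^sub>M count_space UNIV)"
  using dist by (simp add: is_distribution_on_def)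

lemma space_D: "space D = space X \<times> UNIV"
  using sets_eq_imp_space_eq[OF sets_D] by (simp add: space_pair_measure)

lemma measurable_kernel [measurable]: "(\<lambda>x. pmf (K x) y) \<in> borel_measurable X"
  using cond_dist by (simp add: is_cond_dist_def)

lemma sets_marginal [simp, measurable_cong]: "sets (marginal X D) = sets X"
  by (simp add: marginal_def)

lemma space_marginal [simp]: "space (marginal X D) = space X"
  by (simp add: marginal_def)

lemma space_X_nonempty: "space X \<noteq> {}"
  using D.not_empty by (auto simp: space_D)

text \<open>On a set \<open>B\<close> this is the defining identity of the kernel on
  \<open>B \<times> {k}\<close>. Phrased as an equality of measures, it carries over to integrals of
  arbitrary measurable functions.\<close>

lemma distr_label_slice:
  "distr (density D (indicator {z \<in> space D. snd z = k})) X fst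
     = density (marginal X D) (\<lambda>x. ennreal (pmf (K x) k))"
proof (rule measure_eqI)
  fix B assume "B \<in> sets (distr (density D (indicator {z \<in> space D. snd z = k})) X fst)"
  then have B [measurable]: "B \<in> sets X"
    by simp
  have "emeasure (distr (density D (indicator {z \<in> space D. snd z = k})) X fst) B
      = emeasure D ({z \<in> space D. snd z = k} \<inter> (fst -` B \<inter> space D))"
    by (subst emeasure_distr) (simp_all add: emeasure_density
        flip: indicator_inter_arith)
  also have "{z \<in> space D. snd z = k} \<inter> (fst -` B \<inter> space D) = B \<times> {k}"
    using sets.sets_into_space[OF B] by (auto simp: space_D)
  also have "emeasure D (B \<times> {k}) = (\<integral>\<^sup>+x\<in>B. ennreal (pmf (K x) k) \<partial>marginal X D)"
    using cond_dist B unfolding is_cond_dist_def by blast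
  also have "\<dots> = emeasure (density (marginal X D) (\<lambda>x. ennreal (pmf (K x) k))) B"
    by (simp add: emeasure_density)
  finally show "emeasure (distr (density D (indicator {z \<in> space D. snd z = k})) X fst) B
      = emeasure (density (marginal X D) (\<lambda>x. ennreal (pmf (K x) k))) B" .
qed simp

lemma nn_integral_label_slice:
  assumes [measurable]: "g \<in> borel_measurable X"
  shows "(\<integral>\<^sup>+z. g (fst z) * indicator {z \<in> space D. snd z = k} z \<partial>D)
      = (\<integral>\<^sup>+x. g x * ennreal (pmf (K x) k) \<partial>marginal X D)"
proof -
  have "(\<integral>\<^sup>+z. g (fst z) * indicator {z \<in> space D. snd z = k} z \<partial>D)
      = integral\<^sup>N (distr (density D (indicator {z \<in> space D. snd z = k})) X fst) g"
    by (subst nn_integral_distr) (simp_all add: nn_integral_density mult.commute)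
  also have "\<dots> = (\<integral>\<^sup>+x. g x * ennreal (pmf (K x) k) \<partial>marginal X D)"
    unfolding distr_label_slice by (simp add: nn_integral_density mult.commute)
  finally show ?thesis .
qed

lemma emeasure_label:
  "emeasure D {z \<in> space D. snd z = k} = ennreal (label_prob D k)"
  by (simp add: label_prob_def D.emeasure_eq_measure)

lemma nn_integral_kernel:
  "(\<integral>\<^sup>+x. ennreal (pmf (K x) k) \<partial>marginal X D) = ennreal (label_prob D k)"
  using nn_integral_label_slice[of "\<lambda>_. 1" k]
  by (simp add: emeasure_label)

lemma label_prob_nonneg [simp]: "0 \<le> label_prob D k"
  by (simp add: label_prob_def)

end

section \<open>Losses, best losses and the integrated pointwise infimum\<close>

locale deterministic_loss = labelled_distribution X D K
  for X :: "'a measure" and D :: "('a \<times> 'n::finite) measure" and K :: "'a \<Rightarrow> 'n pmf" +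
  fixes l :: "real ^ 'n \<Rightarrow> 'n \<Rightarrow> real" and H :: "('a \<times> 'n \<Rightarrow> real) set" and A :: "(real ^ 'n) set"
  assumes det: "deterministic X D K"
    and measurable_loss: "(\<lambda>(\<alpha>, y). l \<alpha> y) \<in> borel_measurable (borel \<Otimes>\<^sub>M count_space UNIV)"
    and loss_nonneg [simp]: "0 \<le> l \<alpha> y"
    and measurable_H: "H \<subseteq> borel_measurable (X \<Otimes>\<^sub>M count_space UNIV)"
    and scores: "x \<in> space X \<Longrightarrow> {score h x |h. h \<in> H} = A"
begin

lemma measurable_loss_label [measurable]: "(\<lambda>\<alpha>. l \<alpha> k) \<in> borel_measurable borel"
  using measurable_compose[OF _ measurable_loss, of "\<lambda>\<alpha>. (\<alpha>, k)" borel] by simp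

lemma measurable_loss_score [measurable]:
  assumes "h \<in> H"
  shows "(\<lambda>x. l (score h x) k) \<in> borel_measurable X"
proof -
  have [measurable]: "score h \<in> borel_measurable X"
    using assms measurable_H by (intro measurable_score) auto
  show ?thesis
    by measurable
qed

lemma best_loss_le:
  assumes "\<alpha> \<in> A"
  shows "best_loss l A k \<le> l \<alpha> k"
  unfolding best_loss_def using assms
  by (intro cINF_lower bdd_belowI2[of _ 0]) auto

lemma score_in_A:
  assumes "h \<in> H" "x \<in> space X"
  shows "score h x \<in> A"
  using scores[OF assms(2)] assms(1) by auto

text \<open>A real infimum over the empty set is unspecified. The hypothesis
  \<open>h \<in> H\<close> and a point of \<open>space X\<close> make \<open>A\<close>
  nonempty.\<close>

lemma best_loss_nonneg [simp]:
  assumes "h \<in> H"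
  shows "0 \<le> best_loss l A k"
proof -
  obtain x where "x \<in> space X"
    using space_X_nonempty by auto
  then have "A \<noteq> {}"
    using score_in_A[OF assms] by auto
  then show ?thesis
    unfolding best_loss_def by (intro cINF_greatest) auto
qed

lemma nn_integral_loss_label_slice:
  assumes "h \<in> H"
  shows "(\<integral>\<^sup>+z. ennreal (l (score h (fst z)) k) * indicator {z \<in> space D. snd z = k} z \<partial>D)
      = (\<integral>\<^sup>+x. ennreal (l (score h x) k) * ennreal (pmf (K x) k) \<partial>marginal X D)"
  by (rule nn_integral_label_slice) (simp add: assms measurable_loss_score)

text \<open>At each \<open>z\<close> exactly one label indicator is \<open>1\<close>, and on that
  slice \<open>snd z\<close> may be replaced by the constant \<open>k\<close>.\<close>

lemma error_eq_sum:
  assumes "h \<in> H"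
  shows "error D l h
      = (\<Sum>k\<in>UNIV. \<integral>\<^sup>+x. ennreal (l (score h x) k) * ennreal (pmf (K x) k) \<partial>marginal X D)"
proof -
  note [measurable] = measurable_loss_score[OF assms]
  have "error D l h = (\<integral>\<^sup>+z. (\<Sum>k\<in>UNIV. ennreal (l (score h (fst z)) k)
      * indicator {z \<in> space D. snd z = k} z) \<partial>D)"
    unfolding error_def
    by (intro nn_integral_cong) (simp add: indicator_def if_distrib cong: if_cong)
  also have "\<dots> = (\<Sum>k\<in>UNIV. \<integral>\<^sup>+z. ennreal (l (score h (fst z)) k)
      * indicator {z \<in> space D. snd z = k} z \<partial>D)"
    by (rule nn_integral_sum) measurable
  finally show ?thesis
    by (simp add: nn_integral_loss_label_slice[OF assms])
qed

text \<open>The infimum over a possibly uncountable \<open>H\<close> need not be measurable. It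
  agrees almost everywhere with a finite sum of measurable terms, and congruence of nonnegative
  integrals asks for no measurability.\<close>

lemma nn_integral_INF_cond_error:
  assumes "h0 \<in> H"
  shows "(\<integral>\<^sup>+x. (INF h\<in>H. cond_error K l h x) \<partial>marginal X D)
      = (\<Sum>k\<in>UNIV. ennreal (best_loss l A k) * ennreal (label_prob D k))"
proof -
  have "AE x in marginal X D. (INF h\<in>H. cond_error K l h x)
      = (\<Sum>k\<in>UNIV. ennreal (best_loss l A k) * ennreal (pmf (K x) k))"
    using det[unfolded deterministic_def] AE_space
  proof eventually_elim
    case (elim x)
    then obtain j where j: "K x = return_pmf j"
      using deterministic_pmf_eq_return by blast
    \<comment> \<open>Since \<open>A\<close> is the same for every \<open>x\<close>, the infimum
      over \<open>H\<close> at \<open>x\<close> depends on \<open>x\<close> only through the label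
      \<open>j\<close>.\<close>
    have A: "A = (\<lambda>h. score h x) ` H"
      using scores[of x] elim by auto
    have "(INF h\<in>H. cond_error K l h x) = (INF h\<in>H. ennreal (l (score h x) j))"
      by (simp add: cond_error_def j)
    also have "\<dots> = ennreal (best_loss l A j)"
      using assms by (subst ennreal_cINF) (auto simp: best_loss_def A image_image)
    also have "\<dots> = (\<Sum>k\<in>UNIV. ennreal (best_loss l A k) * ennreal (pmf (K x) k))"
      by (simp add: j indicator_def of_bool_def if_distrib cong: if_cong)
    finally show ?case .
  qed
  then have "(\<integral>\<^sup>+x. (INF h\<in>H. cond_error K l h x) \<partial>marginal X D)
      = (\<integral>\<^sup>+x. (\<Sum>k\<in>UNIV. ennreal (best_loss l A k) * ennreal (pmf (K x) k)) \<partial>marginal X D)"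
    by (rule nn_integral_cong_AE)
  also have "\<dots> = (\<Sum>k\<in>UNIV. ennreal (best_loss l A k) * ennreal (label_prob D k))"
    by (simp add: nn_integral_sum nn_integral_cmult nn_integral_kernel)
  finally show ?thesis .
qed

text \<open>This is the summand of label \<open>k\<close> in the gap, already weighted by its
  probability: the kernel restricts the integral to the label region up to a null set. Values in
  \<open>ennreal\<close> make each excess at most the sum and admit infinite errors.\<close>

definition excess :: "('a \<times> 'n \<Rightarrow> real) \<Rightarrow> 'n \<Rightarrow> ennreal" where
  "excess h k =
     (\<integral>\<^sup>+x. ennreal (l (score h x) k - best_loss l A k) * ennreal (pmf (K x) k) \<partial>marginal X D)"

section \<open>The gap, the conditional errors and the almost sure conditions in terms of the
  excess\<close>

lemma label_error_eq_excess:
  assumes "h \<in> H"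
  shows "(\<integral>\<^sup>+x. ennreal (l (score h x) k) * ennreal (pmf (K x) k) \<partial>marginal X D)
      = excess h k + ennreal (best_loss l A k) * ennreal (label_prob D k)"
proof -
  note [measurable] = measurable_loss_score[OF assms]
  have "(\<integral>\<^sup>+x. ennreal (l (score h x) k) * ennreal (pmf (K x) k) \<partial>marginal X D)
     = (\<integral>\<^sup>+x. ennreal (l (score h x) k - best_loss l A k) * ennreal (pmf (K x) k)
         + ennreal (best_loss l A k) * ennreal (pmf (K x) k) \<partial>marginal X D)"
  proof (rule nn_integral_cong)
    fix x assume "x \<in> space (marginal X D)"
    \<comment> \<open>This bound keeps \<open>ennreal\<close> from truncating the difference, so
      adding the best loss back recovers the loss.\<close>
    then have "best_loss l A k \<le> l (score h x) k"
      by (intro best_loss_le score_in_A assms) simp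
    then show "ennreal (l (score h x) k) * ennreal (pmf (K x) k)
       = ennreal (l (score h x) k - best_loss l A k) * ennreal (pmf (K x) k)
         + ennreal (best_loss l A k) * ennreal (pmf (K x) k)"
      using best_loss_nonneg[OF assms]
      by (simp flip: distrib_right ennreal_plus)
  qed
  also have "\<dots> = excess h k + ennreal (best_loss l A k) * ennreal (label_prob D k)"
    by (simp add: excess_def nn_integral_add nn_integral_cmult nn_integral_kernel)
  finally show ?thesis .
qed

lemma minimizability_gap_eq:
  assumes "h \<in> H" "error D l h = (INF h\<in>H. error D l h)"
  shows "minimizability_gap X D K l H = enn2ereal (\<Sum>k\<in>UNIV. excess h k)"
proof -
  define B where "B = (\<Sum>k\<in>UNIV. best_loss l A k * label_prob D k)"
  have B: "(\<Sum>k\<in>UNIV. ennreal (best_loss l A k) * ennreal (label_prob D k)) = ennreal B"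
    unfolding B_def using best_loss_nonneg[OF assms(1)]
    by (simp add: ennreal_mult flip: sum_ennreal)
  have B_nonneg: "0 \<le> B"
    unfolding B_def using best_loss_nonneg[OF assms(1)] by (simp add: sum_nonneg)
  have "error D l h = (\<Sum>k\<in>UNIV. excess h k) + ennreal B"
    by (simp add: error_eq_sum[OF assms(1)] label_error_eq_excess[OF assms(1)] sum.distrib B)
  then have "minimizability_gap X D K l H
      = enn2ereal (\<Sum>k\<in>UNIV. excess h k) + ereal B - ereal B"
    unfolding minimizability_gap_def nn_integral_INF_cond_error[OF assms(1)] B assms(2)[symmetric]
    using B_nonneg by (simp add: plus_ennreal.rep_eq)
  also have "\<dots> = enn2ereal (\<Sum>k\<in>UNIV. excess h k)"
  proof -
    \<comment> \<open>The cancellation also covers an infinite total excess, because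
      \<open>B\<close> is a real number.\<close>
    have "s + ereal B - ereal B = s" for s :: ereal
      by (cases s) auto
    then show ?thesis .
  qed
  finally show ?thesis .
qed

text \<open>Conditioning on the label divides the slice integral by its probability, and the factor
  in front undoes this. For a null label both sides are \<open>0\<close>.\<close>

lemma label_prob_mult_label_cond_error:
  assumes "h \<in> H"
  shows "ereal (label_prob D k) * (label_cond_error D l h k - ereal (best_loss l A k))
      = enn2ereal (excess h k)"
proof (cases "label_prob D k = 0")
  case True
  \<comment> \<open>Even the integrand \<open>top\<close> integrates to \<open>0\<close> against a
    density of total mass \<open>0\<close>, so no bound on the loss is called for.\<close>
  have "excess h k \<le> (\<integral>\<^sup>+x. top * ennreal (pmf (K x) k) \<partial>marginal X D)"
    unfolding excess_def by (intro nn_integral_mono mult_right_mono) auto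
  also have "\<dots> = 0"
    by (simp add: nn_integral_cmult nn_integral_kernel True)
  finally show ?thesis
    using True by (simp add: zero_ennreal.rep_eq)
next
  case False
  define p b where "p = label_prob D k" and "b = best_loss l A k"
  have p: "0 < p"
    using False label_prob_nonneg[of k] by (simp add: p_def less_le)
  have b: "0 \<le> b"
    using best_loss_nonneg[OF assms] by (simp add: b_def)
  note [measurable] = measurable_loss_score[OF assms]
  have "(\<integral>\<^sup>+z. ennreal (l (score h (fst z)) k) \<partial>uniform_measure D {z \<in> space D. snd z = k})
      = (excess h k + ennreal b * ennreal p) / ennreal p"
    by (subst nn_integral_uniform_measure)
      (simp_all add: nn_integral_loss_label_slice[OF assms] label_error_eq_excess[OF assms] emeasure_label p_def b_def)
  then have eq: "label_cond_error D l h k = enn2ereal ((excess h k + ennreal b * ennreal p) / ennreal p)"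
    by (simp add: label_cond_error_def)
  have "ereal p * (label_cond_error D l h k - ereal b) = enn2ereal (excess h k)"
  proof (cases "excess h k")
    case (real e)
    have "(excess h k + ennreal b * ennreal p) / ennreal p = ennreal ((e + b * p) / p)"
      using real p b by (simp add: divide_ennreal flip: ennreal_mult ennreal_plus)
    then show ?thesis
      using real p b by (simp add: eq field_simps)
  next
    \<comment> \<open>Division by the positive real \<open>p\<close> and subtraction of the real
      \<open>b\<close> leave infinity unchanged.\<close>
    case top
    then show ?thesis
      using p by (simp add: eq ennreal_top_divide)
  qed
  then show ?thesis
    by (simp add: p_def b_def)
qed

text \<open>A nonnegative integral vanishes iff its integrand does almost everywhere, and almost
  everywhere the kernel weight is \<open>0\<close> or \<open>1\<close>, the latter exactly on the
  label region.\<close>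

lemma excess_eq_0_iff:
  assumes "h \<in> H"
  shows "excess h k = 0 \<longleftrightarrow>
    (AE x in marginal X D. x \<in> label_region X K k \<longrightarrow> l (score h x) k = best_loss l A k)"
proof -
  note [measurable] = measurable_loss_score[OF assms]
  have "excess h k = 0 \<longleftrightarrow> (AE x in marginal X D.
      ennreal (l (score h x) k - best_loss l A k) * ennreal (pmf (K x) k) = 0)"
    unfolding excess_def by (rule nn_integral_0_iff_AE) measurable
  also have "\<dots> \<longleftrightarrow> (AE x in marginal X D. x \<in> label_region X K k \<longrightarrow>
      l (score h x) k = best_loss l A k)"
  proof (rule eventually_subst)
    show "AE x in marginal X D.
      (ennreal (l (score h x) k - best_loss l A k) * ennreal (pmf (K x) k) = 0) =
      (x \<in> label_region X K k \<longrightarrow> l (score h x) k = best_loss l A k)"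
      using det[unfolded deterministic_def] AE_space
    proof eventually_elim
      case (elim x)
      \<comment> \<open>A zero \<open>ennreal\<close> difference only says that the loss is at most
        the best loss; this is the reverse inequality.\<close>
      then have "best_loss l A k \<le> l (score h x) k"
        by (intro best_loss_le score_in_A assms) simp
      moreover have "pmf (K x) k = 0 \<or> pmf (K x) k = 1"
        using elim by simp
      ultimately show ?case
        using elim by (auto simp: label_region_def ennreal_eq_0_iff)
    qed
  qed
  finally show ?thesis .
qed

end

theorem theorem18:
  fixes X :: "'a measure"
    and D :: "('a \<times> 'n::finite) measure"
    and K :: "'a \<Rightarrow> 'n pmf"
    and l :: "real ^ 'n \<Rightarrow> 'n \<Rightarrow> real"
    and H :: "('a \<times> 'n \<Rightarrow> real) set"
    and A :: "(real ^ 'n) set"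
    and hstar :: "'a \<times> 'n \<Rightarrow> real"
  assumes "is_distribution_on X D"
    and "is_cond_dist X D K"
    and "deterministic X D K"
    and "(\<lambda>(\<alpha>, y). l \<alpha> y) \<in> borel_measurable (borel \<Otimes>\<^sub>M count_space UNIV)"
    and "\<And>\<alpha> y. 0 \<le> l \<alpha> y"
    and "H \<subseteq> borel_measurable (X \<Otimes>\<^sub>M count_space UNIV)"
    and "\<And>x. x \<in> space X \<Longrightarrow> {score h x |h. h \<in> H} = A"
    and "hstar \<in> H"
    and "error D l hstar = (INF h\<in>H. error D l h)"
  shows
    "(minimizability_gap X D K l H = 0 \<longleftrightarrow>
        (\<forall>k. AE x in marginal X D. x \<in> label_region X K k \<longrightarrow>
           l (score hstar x) k = best_loss l A k))
     \<and> (\<forall>\<alpha> :: 'n \<Rightarrow> real ^ 'n.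
          (\<forall>k. inj (\<lambda>a. l a k) \<and> \<alpha> k \<in> A \<and> best_loss l A k = l (\<alpha> k) k) \<longrightarrow>
          ((\<forall>k. AE x in marginal X D. x \<in> label_region X K k \<longrightarrow>
              l (score hstar x) k = best_loss l A k) \<longleftrightarrow>
           (\<forall>k. AE x in marginal X D. x \<in> label_region X K k \<longrightarrow> score hstar x = \<alpha> k)))
     \<and> (\<forall>\<epsilon>::real. 0 \<le> \<epsilon> \<longrightarrow>
          (minimizability_gap X D K l H \<le> ereal \<epsilon> \<longleftrightarrow>
             (\<Sum>k\<in>UNIV. ereal (label_prob D k) *
                (label_cond_error D l hstar k - ereal (best_loss l A k))) \<le> ereal \<epsilon>)
          \<and> ((\<Sum>k\<in>UNIV. ereal (label_prob D k) *
                (label_cond_error D l hstar k - ereal (best_loss l A k))) \<le> ereal \<epsilon> \<longrightarrow>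
             (\<forall>k. label_prob D k > 0 \<longrightarrow>
                label_cond_error D l hstar k - ereal (best_loss l A k)
                  \<le> ereal (\<epsilon> / label_prob D k))))"
proof -
  interpret deterministic_loss X D K l H A
    using assms(1-7)
    by (intro deterministic_loss.intro labelled_distribution.intro deterministic_loss_axioms.intro)
  note gap = minimizability_gap_eq[OF assms(8,9)]
  note label = label_prob_mult_label_cond_error[OF assms(8)]
  \<comment> \<open>The weighted sum equals the gap in the extended reals, so the equivalence for
    each bound \<open>\<epsilon>\<close> is immediate.\<close>
  have sum: "(\<Sum>k\<in>UNIV. ereal (label_prob D k) *
      (label_cond_error D l hstar k - ereal (best_loss l A k)))
      = minimizability_gap X D K l H"
    unfolding gap label by simp
  have null: "minimizability_gap X D K l H = 0 \<longleftrightarrow>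
      (\<forall>k. AE x in marginal X D. x \<in> label_region X K k \<longrightarrow>
         l (score hstar x) k = best_loss l A k)"
    unfolding gap excess_eq_0_iff[OF assms(8), symmetric]
    by (simp add: enn2ereal_inject flip: zero_ennreal.rep_eq)
  have inj: "(\<forall>k. AE x in marginal X D. x \<in> label_region X K k \<longrightarrow>
        l (score hstar x) k = best_loss l A k) \<longleftrightarrow>
      (\<forall>k. AE x in marginal X D. x \<in> label_region X K k \<longrightarrow> score hstar x = \<alpha> k)"
    if "\<forall>k. inj (\<lambda>a. l a k) \<and> \<alpha> k \<in> A \<and> best_loss l A k = l (\<alpha> k) k" for \<alpha>
  proof -
    \<comment> \<open>Injectivity makes the two conditions equivalent at every score vector, hence
      also almost surely.\<close>
    have "l \<beta> k = best_loss l A k \<longleftrightarrow> \<beta> = \<alpha> k" for \<beta> k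
      using that by (auto dest: injD)
    then show ?thesis
      by simp
  qed
  have bound: "label_cond_error D l hstar k - ereal (best_loss l A k) \<le> ereal (\<epsilon> / label_prob D k)"
    if le: "minimizability_gap X D K l H \<le> ereal \<epsilon>" and p: "label_prob D k > 0" for \<epsilon> k
  proof -
    \<comment> \<open>One nonnegative summand is at most the whole sum.\<close>
    have "ereal (label_prob D k) * (label_cond_error D l hstar k - ereal (best_loss l A k))
        \<le> minimizability_gap X D K l H"
      unfolding gap label by (simp add: less_eq_ennreal.rep_eq[symmetric] member_le_sum)
    also note le
    finally show ?thesis
      \<comment> \<open>The value \<open>\<infinity>\<close> is excluded because its product with a
        positive probability would exceed the real bound.\<close>
      using p by (cases "label_cond_error D l hstar k - ereal (best_loss l A k)")
        (auto simp: field_simps)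
  qed
  show ?thesis
    unfolding sum using null inj bound by blast
qed

end
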